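(* Suppose $T$ is a countable complete theory with NIP, and let $\bar M$ be a saturated model of $T$. Let $M_0$ be a countable elementary substructure of $\bar M$. Let $p(x)$ be a complete $1$-type over $\bar M$ which is finitely satisfiable in $M_0$. Let $U=\{X\cap M_0: X\in p\}$. Then $U$ is a Borel (in fact an $F_\sigma$) subset of the Polish space $2^{M_0}$.
   Context: $\bar M$ is a large saturated model of $T$. $T$ has NIP if there is no formula $\phi(x,y)$ of the language together with $\langle a_i:i<\omega\rangle$ and $\langle b_w:w\subseteq\omega\rangle$ in $\bar M$ such that $\models\phi(a_i,b_w)$ iff $i\in w$. A complete type $p$ over $\bar M$ is identified with the family of definable (with parameters in $\bar M$) sets $X\subseteq\bar M$ whose defining formula belongs to $p$; thus "$X\in p$" means that the formula defining $X$ is in $p$. $p$ is finitely satisfiable in $M_0$ if every formula in $p$ is satisfied by an element of $M_0$. The power set of $M_0$ is identified with $2^{M_0}$ with the product topology. *)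

theory Defs
  imports "HOL-Analysis.Analysis"
begin

section \<open>First-order logic with equality\<close>

text \<open>The symbols of a language are explicit sets inside the types \<open>'f\<close> and \<open>'r\<close>, so a language
  may have no function or no relation symbols at all. Constants are function symbols of arity 0.\<close>

record ('f, 'r) language =
  fun_syms :: "'f set"
  rel_syms :: "'r set"
  fun_arity :: "'f \<Rightarrow> nat"
  rel_arity :: "'r \<Rightarrow> nat"

definition countable_language :: "('f, 'r) language \<Rightarrow> bool" where
  "countable_language L \<longleftrightarrow> countable (fun_syms L) \<and> countable (rel_syms L)"

datatype 'f trm = Var nat | Fn 'f "'f trm list"

datatype ('f, 'r) fm =
    Equal "'f trm" "'f trm"
  | Rel 'r "'f trm list"
  | Neg "('f, 'r) fm"
  | Conj "('f, 'r) fm" "('f, 'r) fm"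
  | Exists nat "('f, 'r) fm"

fun wf_trm :: "('f, 'r) language \<Rightarrow> 'f trm \<Rightarrow> bool" where
  "wf_trm L (Var i) \<longleftrightarrow> True"
| "wf_trm L (Fn f ts) \<longleftrightarrow>
     f \<in> fun_syms L \<and> length ts = fun_arity L f \<and> (\<forall>t\<in>set ts. wf_trm L t)"

fun wf_fm :: "('f, 'r) language \<Rightarrow> ('f, 'r) fm \<Rightarrow> bool" where
  "wf_fm L (Equal s t) \<longleftrightarrow> wf_trm L s \<and> wf_trm L t"
| "wf_fm L (Rel r ts) \<longleftrightarrow>
     r \<in> rel_syms L \<and> length ts = rel_arity L r \<and> (\<forall>t\<in>set ts. wf_trm L t)"
| "wf_fm L (Neg \<phi>) \<longleftrightarrow> wf_fm L \<phi>"
| "wf_fm L (Conj \<phi> \<psi>) \<longleftrightarrow> wf_fm L \<phi> \<and> wf_fm L \<psi>"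
| "wf_fm L (Exists i \<phi>) \<longleftrightarrow> wf_fm L \<phi>"

fun fv_trm :: "'f trm \<Rightarrow> nat set" where
  "fv_trm (Var i) = {i}"
| "fv_trm (Fn f ts) = (\<Union>t\<in>set ts. fv_trm t)"

fun fv :: "('f, 'r) fm \<Rightarrow> nat set" where
  "fv (Equal s t) = fv_trm s \<union> fv_trm t"
| "fv (Rel r ts) = (\<Union>t\<in>set ts. fv_trm t)"
| "fv (Neg \<phi>) = fv \<phi>"
| "fv (Conj \<phi> \<psi>) = fv \<phi> \<union> fv \<psi>"
| "fv (Exists i \<phi>) = fv \<phi> - {i}"

record ('f, 'r, 'm) struct =
  univ :: "'m set"
  fun_interp :: "'f \<Rightarrow> 'm list \<Rightarrow> 'm"
  rel_interp :: "'r \<Rightarrow> 'm list \<Rightarrow> bool"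

definition is_structure :: "('f, 'r) language \<Rightarrow> ('f, 'r, 'm) struct \<Rightarrow> bool" where
  "is_structure L M \<longleftrightarrow> univ M \<noteq> {} \<and>
     (\<forall>f\<in>fun_syms L. \<forall>as. length as = fun_arity L f \<and> set as \<subseteq> univ M \<longrightarrow>
        fun_interp M f as \<in> univ M)"

fun trm_val :: "('f, 'r, 'm) struct \<Rightarrow> (nat \<Rightarrow> 'm) \<Rightarrow> 'f trm \<Rightarrow> 'm" where
  "trm_val M e (Var i) = e i"
| "trm_val M e (Fn f ts) = fun_interp M f (map (trm_val M e) ts)"

fun sat :: "('f, 'r, 'm) struct \<Rightarrow> (nat \<Rightarrow> 'm) \<Rightarrow> ('f, 'r) fm \<Rightarrow> bool" where
  "sat M e (Equal s t) \<longleftrightarrow> trm_val M e s = trm_val M e t"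
| "sat M e (Rel r ts) \<longleftrightarrow> rel_interp M r (map (trm_val M e) ts)"
| "sat M e (Neg \<phi>) \<longleftrightarrow> \<not> sat M e \<phi>"
| "sat M e (Conj \<phi> \<psi>) \<longleftrightarrow> sat M e \<phi> \<and> sat M e \<psi>"
| "sat M e (Exists i \<phi>) \<longleftrightarrow> (\<exists>a\<in>univ M. sat M (e(i := a)) \<phi>)"

lemma trm_val_cong:
  "(\<And>i. i \<in> fv_trm t \<Longrightarrow> e i = e' i) \<Longrightarrow> trm_val M e t = trm_val M e' t"
  by (induction t) (auto intro!: arg_cong[where f = "fun_interp M _"] map_cong)

text \<open>Only the values at the free variables matter. Below, a tuple \<open>as\<close> is used as the valuation
  \<open>nth as\<close>, always for a formula whose free variables are below \<open>length as\<close>.\<close>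

lemma sat_cong:
  "(\<And>i. i \<in> fv \<phi> \<Longrightarrow> e i = e' i) \<Longrightarrow> sat M e \<phi> = sat M e' \<phi>"
proof (induction \<phi> arbitrary: e e')
  case (Equal s t)
  then show ?case using trm_val_cong[of s e e' M] trm_val_cong[of t e e' M] by auto
next
  case (Rel r ts)
  then have "map (trm_val M e) ts = map (trm_val M e') ts"
    by (intro map_cong refl trm_val_cong) auto
  then show ?case by (simp only: sat.simps)
next
  case (Neg \<phi>)
  then show ?case by (metis fv.simps(3) sat.simps(3))
next
  case (Conj \<phi> \<psi>)
  then show ?case by (metis UnCI fv.simps(4) sat.simps(4))
next
  case (Exists i \<phi>)
  have "sat M (e(i := a)) \<phi> = sat M (e'(i := a)) \<phi>" for a
    by (rule Exists.IH) (use Exists.prems in auto)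
  then show ?case by simp
qed


section \<open>Theories, models, elementary substructures\<close>

definition sentences :: "('f, 'r) language \<Rightarrow> ('f, 'r) fm set" where
  "sentences L = {\<phi>. wf_fm L \<phi> \<and> fv \<phi> = {}}"

text \<open>Theories are deductively closed, so a complete theory contains each sentence or its negation.
  Its consistency is not part of this predicate: it follows as soon as there is a model.\<close>

definition complete_theory :: "('f, 'r) language \<Rightarrow> ('f, 'r) fm set \<Rightarrow> bool" where
  "complete_theory L T \<longleftrightarrow> T \<subseteq> sentences L \<and> (\<forall>\<phi>\<in>sentences L. \<phi> \<in> T \<or> Neg \<phi> \<in> T)"

definition is_model :: "('f, 'r) language \<Rightarrow> ('f, 'r) fm set \<Rightarrow> ('f, 'r, 'm) struct \<Rightarrow> bool" where
  "is_model L T M \<longleftrightarrow> is_structure L M \<and> (\<forall>\<phi>\<in>T. \<forall>e. range e \<subseteq> univ M \<longrightarrow> sat M e \<phi>)"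

definition elementary_substructure ::
  "('f, 'r) language \<Rightarrow> ('f, 'r, 'm) struct \<Rightarrow> ('f, 'r, 'm) struct \<Rightarrow> bool" where
  "elementary_substructure L N M \<longleftrightarrow>
     is_structure L N \<and> is_structure L M \<and> univ N \<subseteq> univ M \<and>
     (\<forall>f\<in>fun_syms L. \<forall>as. length as = fun_arity L f \<and> set as \<subseteq> univ N \<longrightarrow>
        fun_interp N f as = fun_interp M f as) \<and>
     (\<forall>r\<in>rel_syms L. \<forall>as. length as = rel_arity L r \<and> set as \<subseteq> univ N \<longrightarrow>
        rel_interp N r as = rel_interp M r as) \<and>
     (\<forall>\<phi> e. wf_fm L \<phi> \<and> range e \<subseteq> univ N \<longrightarrow> (sat N e \<phi> \<longleftrightarrow> sat M e \<phi>))"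


section \<open>NIP\<close>

text \<open>In \<open>\<phi>(x, y)\<close> the variables \<open>x\<close>, \<open>y\<close> are finite tuples, of lengths \<open>m\<close> and \<open>n\<close>. NIP of a
  complete theory is read in a fixed large saturated model \<open>M\<close>.\<close>

definition NIP_in :: "('f, 'r) language \<Rightarrow> ('f, 'r, 'm) struct \<Rightarrow> bool" where
  "NIP_in L M \<longleftrightarrow>
     \<not> (\<exists>\<phi> m n (a :: nat \<Rightarrow> 'm list) (b :: nat set \<Rightarrow> 'm list).
          wf_fm L \<phi> \<and> fv \<phi> \<subseteq> {..<m + n} \<and>
          (\<forall>i. length (a i) = m \<and> set (a i) \<subseteq> univ M) \<and>
          (\<forall>w. length (b w) = n \<and> set (b w) \<subseteq> univ M) \<and>
          (\<forall>i w. sat M (nth (a i @ b w)) \<phi> \<longleftrightarrow> i \<in> w))"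


section \<open>Types and saturation\<close>

text \<open>A formula \<open>\<phi>(x, b)\<close> in the single variable \<open>x\<close> with parameters from \<open>A\<close> is a pair \<open>(\<phi>, b)\<close>:
  variable \<open>0\<close> of \<open>\<phi>\<close> is \<open>x\<close>, and variable \<open>k + 1\<close> stands for the parameter \<open>b ! k\<close>.\<close>

type_synonym ('f, 'r, 'm) pfm = "('f, 'r) fm \<times> 'm list"

definition param_formulas ::
  "('f, 'r) language \<Rightarrow> 'm set \<Rightarrow> ('f, 'r, 'm) pfm set" where
  "param_formulas L A =
     {(\<phi>, b). wf_fm L \<phi> \<and> fv \<phi> \<subseteq> {..<Suc (length b)} \<and> set b \<subseteq> A}"

definition solutions :: "('f, 'r, 'm) struct \<Rightarrow> ('f, 'r, 'm) pfm \<Rightarrow> 'm set" where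
  "solutions M q = {a \<in> univ M. sat M (nth (a # snd q)) (fst q)}"

definition one_type ::
  "('f, 'r) language \<Rightarrow> ('f, 'r, 'm) struct \<Rightarrow> 'm set \<Rightarrow> ('f, 'r, 'm) pfm set \<Rightarrow> bool" where
  "one_type L M A p \<longleftrightarrow> p \<subseteq> param_formulas L A \<and>
     (\<forall>q\<subseteq>p. finite q \<longrightarrow> (\<exists>a\<in>univ M. \<forall>\<theta>\<in>q. a \<in> solutions M \<theta>))"

definition complete_one_type ::
  "('f, 'r) language \<Rightarrow> ('f, 'r, 'm) struct \<Rightarrow> 'm set \<Rightarrow> ('f, 'r, 'm) pfm set \<Rightarrow> bool" where
  "complete_one_type L M A p \<longleftrightarrow> one_type L M A p \<and>
     (\<forall>(\<phi>, b)\<in>param_formulas L A. (\<phi>, b) \<in> p \<or> (Neg \<phi>, b) \<in> p)"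

definition saturated :: "('f, 'r) language \<Rightarrow> ('f, 'r, 'm) struct \<Rightarrow> bool" where
  "saturated L M \<longleftrightarrow>
     (\<forall>A p. A \<subseteq> univ M \<and> A \<prec> univ M \<and> one_type L M A p \<longrightarrow>
        (\<exists>a\<in>univ M. \<forall>\<theta>\<in>p. a \<in> solutions M \<theta>))"

definition finitely_satisfiable_in ::
  "('f, 'r, 'm) struct \<Rightarrow> ('f, 'r, 'm) pfm set \<Rightarrow> 'm set \<Rightarrow> bool" where
  "finitely_satisfiable_in M p A \<longleftrightarrow> (\<forall>\<theta>\<in>p. \<exists>a\<in>A. a \<in> solutions M \<theta>)"

text \<open>The definable sets \<open>X\<close> with \<open>X \<in> p\<close>.\<close>

definition sets_of_type :: "('f, 'r, 'm) struct \<Rightarrow> ('f, 'r, 'm) pfm set \<Rightarrow> 'm set set" where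
  "sets_of_type M p = solutions M ` p"


section \<open>The space of subsets of a set\<close>

text \<open>\<open>Pow A\<close> with the topology of the product \<open>2\<^sup>A\<close>, via characteristic functions.\<close>

definition powerset_topology :: "'a set \<Rightarrow> 'a set topology" where
  "powerset_topology A =
     pullback_topology (Pow A) (\<lambda>X. \<lambda>a\<in>A. a \<in> X)
       (product_topology (\<lambda>_. discrete_topology (UNIV :: bool set)) A)"

definition borel_in :: "'a topology \<Rightarrow> 'a set \<Rightarrow> bool" where
  "borel_in X S \<longleftrightarrow> S \<in> sigma_sets (topspace X) {V. openin X V}"

end

theory Submission
  imports Defs
begin

text \<open>If \<open>M\<close> is countable, then so is \<open>U\<close>. Otherwise \<open>M\<close> is \<open>\<aleph>\<^sub>1\<close>-saturated, and it is enough
  to treat one formula \<open>\<phi>(x, y)\<close> at a time. The traces \<open>\<phi>(N, b)\<close> form a compact set \<open>C\<close>; let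
  \<open>D\<close> be the set of those with \<open>\<phi>(x, b) \<in> p\<close>. Remove from \<open>C\<close> all cylinders in which \<open>D\<close>
  is \<open>F\<^sub>\<sigma>\<close>. If a nonempty closed set \<open>K\<close> is left, then \<open>D\<close> and its complement are both dense
  in \<open>K\<close>, since a cylinder meeting \<open>K\<close> inside \<open>D\<close> or off \<open>D\<close> would itself have been removed.
  Given finitely many members and non-members of \<open>D\<close>, finite satisfiability of \<open>p\<close> in \<open>N\<close> gives
  a point of \<open>N\<close> lying in all the former and in none of the latter. Choosing such points
  repeatedly, for members and non-members of \<open>D\<close> in each of the \<open>2\<^sup>n\<close> cylinders already cut out,
  produces a sequence in \<open>N\<close> shattered by \<open>C\<close>, against NIP. So \<open>D\<close> is \<open>F\<^sub>\<sigma>\<close>.\<close>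

section \<open>The space of subsets of a countable set\<close>

lemma topspace_powerset_topology [simp]: "topspace (powerset_topology A) = Pow A"
  by (auto simp: powerset_topology_def topspace_pullback_topology)

lemma openin_powerset_topology_member:
  assumes "a \<in> A"
  shows "openin (powerset_topology A) {X. X \<subseteq> A \<and> (a \<in> X \<longleftrightarrow> v)}"
proof -
  let ?P = "product_topology (\<lambda>_. discrete_topology (UNIV :: bool set)) A"
  have "openin ?P {x \<in> topspace ?P. x a \<in> {v}}"
    using continuous_map_product_projection[OF assms]
    by (rule openin_continuous_map_preimage) simp
  moreover have "{X. X \<subseteq> A \<and> (a \<in> X \<longleftrightarrow> v)} =
      (\<lambda>X. \<lambda>a\<in>A. a \<in> X) -` {x \<in> topspace ?P. x a \<in> {v}} \<inter> Pow A"
    using assms by auto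
  ultimately show ?thesis
    unfolding powerset_topology_def openin_pullback_topology by blast
qed

text \<open>Both sets may be infinite: finite \<open>s\<close> and \<open>t\<close> give the basic
  clopen sets, while \<open>t = A - s\<close> with \<open>s \<subseteq> A\<close> leaves a single
  point.\<close>

definition cylinder :: "'a set \<Rightarrow> 'a set \<Rightarrow> 'a set \<Rightarrow> 'a set set" where
  "cylinder A s t = {X. X \<subseteq> A \<and> s \<subseteq> X \<and> X \<inter> t = {}}"

lemma openin_cylinder:
  assumes "finite s" "finite t" "s \<subseteq> A" "t \<subseteq> A"
  shows "openin (powerset_topology A) (cylinder A s t)"
proof -
  let ?F = "insert (Pow A)
    ((\<lambda>a. {X. X \<subseteq> A \<and> (a \<in> X \<longleftrightarrow> True)}) ` s \<union> (\<lambda>a. {X. X \<subseteq> A \<and> (a \<in> X \<longleftrightarrow> False)}) ` t)"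
  have "openin (powerset_topology A) (\<Inter>?F)"
  proof (rule openin_Inter)
    show "\<And>V. V \<in> ?F \<Longrightarrow> openin (powerset_topology A) V"
      using assms openin_powerset_topology_member[of _ A True]
        openin_powerset_topology_member[of _ A False] openin_topspace[of "powerset_topology A"]
      by auto
  qed (use assms in auto)
  moreover have "\<Inter>?F = cylinder A s t"
    by (auto simp: cylinder_def)
  ultimately show ?thesis by simp
qed

text \<open>A cylinder is an intersection of clopen conditions on single points; even infinitely
  many of them give a closed set.\<close>

lemma closedin_cylinder:
  assumes "s \<subseteq> A" "t \<subseteq> A"
  shows "closedin (powerset_topology A) (cylinder A s t)"
proof -
  have "Pow A - cylinder A s t = (\<Union>a\<in>s. cylinder A {} {a}) \<union> (\<Union>a\<in>t. cylinder A {a} {})"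
    by (auto simp: cylinder_def)
  moreover have "openin (powerset_topology A)
      ((\<Union>a\<in>s. cylinder A {} {a}) \<union> (\<Union>a\<in>t. cylinder A {a} {}))"
    using assms by (intro openin_Un openin_Union) (auto intro!: openin_cylinder)
  ultimately have "openin (powerset_topology A) (Pow A - cylinder A s t)" by (simp only:)
  moreover have "cylinder A s t \<subseteq> Pow A" by (auto simp: cylinder_def)
  ultimately show ?thesis by (simp add: closedin_def)
qed

lemma countable_imp_fsigma_in_powerset_topology:
  assumes "countable U" "U \<subseteq> Pow A"
  shows "fsigma_in (powerset_topology A) U"
proof -
  have "fsigma_in (powerset_topology A) (\<Union>((\<lambda>X. {X}) ` U))"
  proof (rule fsigma_in_Union)
    fix S assume "S \<in> (\<lambda>X. {X}) ` U"
    then obtain X where X: "S = {X}" "X \<subseteq> A" using assms by auto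
    then have "S = cylinder A X (A - X)" by (auto simp: cylinder_def)
    then show "fsigma_in (powerset_topology A) S"
      using X by (auto intro!: closed_imp_fsigma_in closedin_cylinder)
  qed (use assms in auto)
  then show ?thesis by simp
qed

lemma fsigma_in_imp_borel_in:
  assumes "fsigma_in X S"
  shows "borel_in X S"
proof -
  let ?B = "sigma_sets (topspace X) {V. openin X V}"
  have closed: "C \<in> ?B" if "closedin X C" for C
  proof -
    have "topspace X - (topspace X - C) \<in> ?B"
      using that by (intro sigma_sets.Compl sigma_sets.Basic) (auto simp: closedin_def)
    then show ?thesis using closedin_subset[OF that] by (simp add: double_diff)
  qed
  obtain C where "\<forall>n. closedin X (C n)" "(\<Union>n::nat. C n) = S"
    using assms unfolding fsigma_in_ascending by auto
  moreover from this have "(\<Union>n. C n) \<in> ?B"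
    by (intro sigma_sets.Union closed) simp
  ultimately show ?thesis
    by (simp add: borel_in_def)
qed

text \<open>Equivalent to compactness of \<open>C\<close>, but in the form in which saturation delivers it and without
  a detour through Tychonoff's theorem.\<close>

definition pattern_compact :: "'a set \<Rightarrow> 'a set set \<Rightarrow> bool" where
  "pattern_compact A C \<longleftrightarrow> C \<subseteq> Pow A \<and>
     (\<forall>s t. s \<subseteq> A \<and> t \<subseteq> A \<and>
        (\<forall>s' t'. finite s' \<and> s' \<subseteq> s \<and> finite t' \<and> t' \<subseteq> t \<longrightarrow> C \<inter> cylinder A s' t' \<noteq> {})
        \<longrightarrow> C \<inter> cylinder A s t \<noteq> {})"

lemma pattern_compactD:
  assumes "pattern_compact A C" "s \<subseteq> A" "t \<subseteq> A"
    and "\<And>s' t'. finite s' \<Longrightarrow> s' \<subseteq> s \<Longrightarrow> finite t' \<Longrightarrow> t' \<subseteq> t \<Longrightarrow> C \<inter> cylinder A s' t' \<noteq> {}"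
  obtains X where "X \<in> C" "s \<subseteq> X" "X \<inter> t = {}"
proof -
  have "C \<inter> cylinder A s t \<noteq> {}"
    using assms(1)[unfolded pattern_compact_def, THEN conjunct2, rule_format, of s t] assms(2-4)
    by simp
  then show ?thesis using that by (auto simp: cylinder_def)
qed

text \<open>If every basic neighbourhood of \<open>S\<close> meets \<open>C\<close>, then the
  pattern \<open>(S, A - S)\<close> is finitely realised in \<open>C\<close>; an element of
  \<open>C\<close> realising all of it can only be \<open>S\<close>.\<close>

lemma pattern_compact_imp_closedin:
  assumes "pattern_compact A C"
  shows "closedin (powerset_topology A) C"
proof -
  have sub: "C \<subseteq> Pow A" using assms by (simp add: pattern_compact_def)
  have "\<exists>V. openin (powerset_topology A) V \<and> S \<in> V \<and> V \<subseteq> Pow A - C" if S: "S \<in> Pow A - C" for S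
  proof (rule ccontr)
    assume neg: "\<not> ?thesis"
    obtain X where X: "X \<in> C" "S \<subseteq> X" "X \<inter> (A - S) = {}"
    proof (rule pattern_compactD[OF assms])
      fix s' t' assume st: "finite s'" "s' \<subseteq> S" "finite t'" "t' \<subseteq> A - S"
      then have "openin (powerset_topology A) (cylinder A s' t')" "S \<in> cylinder A s' t'"
        using S by (auto intro!: openin_cylinder) (auto simp: cylinder_def)
      then have "\<not> cylinder A s' t' \<subseteq> Pow A - C" using neg by blast
      then show "C \<inter> cylinder A s' t' \<noteq> {}" by (auto simp: cylinder_def)
    qed (use S in auto)
    then have "X = S" using sub by blast
    then show False using X S by simp
  qed
  then have "openin (powerset_topology A) (Pow A - C)"
    by (subst openin_subopen) blast
  then show ?thesis using sub by (simp add: closedin_def)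
qed

section \<open>Shattered sequences and the F-sigma criterion\<close>

definition independent_in :: "'a set set \<Rightarrow> 'a list \<Rightarrow> bool" where
  "independent_in K as \<longleftrightarrow> (\<forall>w. \<exists>X\<in>K. \<forall>i<length as. as ! i \<in> X \<longleftrightarrow> i \<in> w)"

text \<open>Density gives, for each pattern \<open>w\<close> on \<open>as\<close>, a member
  \<open>P w\<close> of \<open>D\<close> and a member \<open>Q w\<close> off \<open>D\<close>
  realising it. A point in every \<open>P w\<close> and in no \<open>Q w\<close> can be appended: a
  longer pattern takes its witness from \<open>P\<close> or from \<open>Q\<close> according to
  whether it contains the new index.\<close>

lemma independent_in_extend:
  assumes as: "independent_in K as" "set as \<subseteq> A"
    and K: "K \<subseteq> Pow A"
    and sep: "\<And>G H. finite G \<Longrightarrow> G \<subseteq> K \<inter> D \<Longrightarrow> finite H \<Longrightarrow> H \<subseteq> K - D \<Longrightarrow>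
      \<exists>a\<in>A. (\<forall>X\<in>G. a \<in> X) \<and> (\<forall>X\<in>H. a \<notin> X)"
    and dense: "\<And>s t. finite s \<Longrightarrow> finite t \<Longrightarrow> s \<subseteq> A \<Longrightarrow> t \<subseteq> A \<Longrightarrow> K \<inter> cylinder A s t \<noteq> {} \<Longrightarrow>
      K \<inter> cylinder A s t \<inter> D \<noteq> {} \<and> (K - D) \<inter> cylinder A s t \<noteq> {}"
  shows "\<exists>a\<in>A. independent_in K (as @ [a])"
proof -
  let ?n = "length as"
  have "\<exists>P Q. P \<in> K \<inter> D \<and> Q \<in> K - D \<and>
      (\<forall>i<?n. (as ! i \<in> P \<longleftrightarrow> i \<in> w) \<and> (as ! i \<in> Q \<longleftrightarrow> i \<in> w))" for w
  proof -
    define s where "s = (!) as ` ({..<?n} \<inter> w)"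
    define t where "t = (!) as ` ({..<?n} - w)"
    have st: "finite s" "finite t" "s \<subseteq> A" "t \<subseteq> A"
      using as(2) by (auto simp: s_def t_def)
    obtain X where X: "X \<in> K" "\<forall>i<?n. as ! i \<in> X \<longleftrightarrow> i \<in> w"
      using as(1) unfolding independent_in_def by blast
    then have "X \<in> cylinder A s t"
      using K by (auto simp: cylinder_def s_def t_def)
    then have "K \<inter> cylinder A s t \<inter> D \<noteq> {} \<and> (K - D) \<inter> cylinder A s t \<noteq> {}"
      using st X by (intro dense) auto
    then obtain P Q where PQ: "P \<in> K \<inter> D" "Q \<in> K - D" "P \<in> cylinder A s t" "Q \<in> cylinder A s t"
      by blast
    have "as ! i \<in> Y \<longleftrightarrow> i \<in> w" if "Y \<in> cylinder A s t" "i < ?n" for Y i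
      using that by (auto simp: cylinder_def s_def t_def)
    then show ?thesis using PQ by blast
  qed
  then obtain P Q where PQ: "\<And>w. P w \<in> K \<inter> D" "\<And>w. Q w \<in> K - D"
    "\<And>w i. i < ?n \<Longrightarrow> as ! i \<in> P w \<longleftrightarrow> i \<in> w" "\<And>w i. i < ?n \<Longrightarrow> as ! i \<in> Q w \<longleftrightarrow> i \<in> w"
    by metis
  \<comment> \<open>Only subsets of the index set are used, since separation is available for finite
    families.\<close>
  have "\<exists>a\<in>A. (\<forall>X\<in>P ` Pow {..<?n}. a \<in> X) \<and> (\<forall>X\<in>Q ` Pow {..<?n}. a \<notin> X)"
    using PQ(1,2) by (intro sep) auto
  then obtain a where a: "a \<in> A" "\<And>w. w \<subseteq> {..<?n} \<Longrightarrow> a \<in> P w" "\<And>w. w \<subseteq> {..<?n} \<Longrightarrow> a \<notin> Q w"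
    by auto
  have "\<exists>X\<in>K. \<forall>i<length (as @ [a]). (as @ [a]) ! i \<in> X \<longleftrightarrow> i \<in> w" for w
  proof -
    define X where "X = (if ?n \<in> w then P (w \<inter> {..<?n}) else Q (w \<inter> {..<?n}))"
    have "X \<in> K" "a \<in> X \<longleftrightarrow> ?n \<in> w" "\<And>i. i < ?n \<Longrightarrow> as ! i \<in> X \<longleftrightarrow> i \<in> w"
      using PQ(1,2)[of "w \<inter> {..<?n}"] a(2,3)[of "w \<inter> {..<?n}"] by (auto simp: X_def PQ(3,4))
    then show ?thesis
      by (intro bexI[of _ X]) (simp_all add: nth_append less_Suc_eq)
  qed
  then show ?thesis using a(1) unfolding independent_in_def by blast
qed

text \<open>The lists are chosen to extend one another, so they have a limit \<open>a\<close>. Each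
  infinite pattern on \<open>a\<close> is finitely realised in \<open>K \<subseteq> C\<close>, and
  compactness of \<open>C\<close> realises it as a whole.\<close>

lemma independent_sequence:
  assumes K: "K \<noteq> {}" "K \<subseteq> C" and C: "pattern_compact A C"
    and extend: "\<And>as. set as \<subseteq> A \<Longrightarrow> independent_in K as \<Longrightarrow> \<exists>a\<in>A. independent_in K (as @ [a])"
  shows "\<exists>a X. range a \<subseteq> A \<and> range X \<subseteq> C \<and> (\<forall>i w. a (i::nat) \<in> X w \<longleftrightarrow> i \<in> w)"
proof -
  have "\<exists>f. \<forall>n. (set (f n) \<subseteq> A \<and> length (f n) = n \<and> independent_in K (f n)) \<and>
      (\<exists>a. f (Suc n) = f n @ [a])"
  proof (rule dependent_nat_choice)
    show "\<exists>x. set x \<subseteq> A \<and> length x = 0 \<and> independent_in K x"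
      using K by (auto simp: independent_in_def)
  next
    fix x n assume "set x \<subseteq> A \<and> length x = n \<and> independent_in K x"
    moreover from this obtain a where "a \<in> A" "independent_in K (x @ [a])"
      using extend[of x] by blast
    ultimately show "\<exists>y. (set y \<subseteq> A \<and> length y = Suc n \<and> independent_in K y) \<and> (\<exists>a. y = x @ [a])"
      by (intro exI[of _ "x @ [a]"]) auto
  qed
  then obtain f where f: "\<And>n. set (f n) \<subseteq> A" "\<And>n. length (f n) = n" "\<And>n. independent_in K (f n)"
    and step: "\<And>n. \<exists>a. f (Suc n) = f n @ [a]" by blast
  define a where "a i = f (Suc i) ! i" for i
  have a_eq: "f n ! i = a i" if "i < n" for n i
    using that
  proof (induction n)
    case (Suc n)
    show ?case
    proof (cases "i = n")
      case False
      then show ?thesis using Suc step[of n] f(2)[of n] by (auto simp: nth_append)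
    qed (simp add: a_def)
  qed simp
  have a_A: "a i \<in> A" for i
    using f(1,2)[of "Suc i"] nth_mem[of i "f (Suc i)"] by (auto simp: a_def)
  have "\<exists>X. X \<in> C \<and> (\<forall>i. a i \<in> X \<longleftrightarrow> i \<in> w)" for w
  proof -
    obtain X where "X \<in> C" "a ` w \<subseteq> X" "X \<inter> a ` (- w) = {}"
    proof (rule pattern_compactD[OF C])
      fix s' t' assume "finite s'" "s' \<subseteq> a ` w" "finite t'" "t' \<subseteq> a ` (- w)"
      then obtain u v where uv: "finite u" "u \<subseteq> w" "s' = a ` u" "finite v" "v \<subseteq> - w" "t' = a ` v"
        by (metis finite_subset_image)
      \<comment> \<open>A stage long enough to contain all the indices in question realises the
        whole finite pattern.\<close>
      obtain n where n: "u \<union> v \<subseteq> {..<n}"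
        using uv finite_nat_bounded[of "u \<union> v"] by auto
      obtain X where X: "X \<in> K" "\<forall>i<n. f n ! i \<in> X \<longleftrightarrow> i \<in> w"
        using f(3)[of n] f(2)[of n] unfolding independent_in_def by auto
      have "X \<subseteq> A" using X K C by (auto simp: pattern_compact_def)
      moreover have "a i \<in> X \<longleftrightarrow> i \<in> w" if "i \<in> u \<union> v" for i
      proof -
        have "i < n" using n that by blast
        then show ?thesis using X(2) a_eq by metis
      qed
      ultimately have "X \<in> cylinder A s' t'"
        using uv(2,3,5,6) by (auto simp: cylinder_def)
      then show "C \<inter> cylinder A s' t' \<noteq> {}" using X K by blast
    qed (use a_A in auto)
    then show ?thesis by (intro exI[of _ X]) auto
  qed
  then obtain X where "\<And>w. X w \<in> C" "\<And>w i. a i \<in> X w \<longleftrightarrow> i \<in> w" by metis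
  then show ?thesis using a_A by blast
qed

text \<open>One removal step suffices: \<open>G\<close> collects every cylinder over finite sets in
  which \<open>D\<close> is F-sigma. These are countably many, so \<open>D\<close> is F-sigma within
  \<open>G\<close>. If the remainder \<open>K\<close> were nonempty, independent lists could be
  extended forever.\<close>

lemma fsigma_in_if_no_independent_sequence:
  assumes A: "countable A" and C: "pattern_compact A C" and D: "D \<subseteq> C"
    and sep: "\<And>G H. finite G \<Longrightarrow> G \<subseteq> D \<Longrightarrow> finite H \<Longrightarrow> H \<subseteq> C - D \<Longrightarrow>
      \<exists>a\<in>A. (\<forall>X\<in>G. a \<in> X) \<and> (\<forall>X\<in>H. a \<notin> X)"
    and dependent: "\<not> (\<exists>a X. range a \<subseteq> A \<and> range X \<subseteq> C \<and> (\<forall>i w. a (i::nat) \<in> X w \<longleftrightarrow> i \<in> w))"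
  shows "fsigma_in (powerset_topology A) D"
proof -
  let ?T = "powerset_topology A"
  define I where "I = {(s, t). finite s \<and> finite t \<and> s \<subseteq> A \<and> t \<subseteq> A \<and>
    fsigma_in ?T (cylinder A s t \<inter> D)}"
  define G where "G = (\<Union>(s, t)\<in>I. cylinder A s t)"
  define K where "K = C - G"
  have "countable ({s. finite s \<and> s \<subseteq> A} \<times> {s. finite s \<and> s \<subseteq> A})"
    using A by (intro countable_SIGMA countable_Collect_finite_subset)
  then have I: "countable I"
    by (rule countable_subset[rotated]) (auto simp: I_def)
  have GD: "fsigma_in ?T (G \<inter> D)"
  proof -
    have "fsigma_in ?T (\<Union>((\<lambda>(s, t). cylinder A s t \<inter> D) ` I))"
      using I by (intro fsigma_in_Union) (auto simp: I_def)
    moreover have "\<Union>((\<lambda>(s, t). cylinder A s t \<inter> D) ` I) = G \<inter> D"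
      by (auto simp: G_def)
    ultimately show ?thesis by simp
  qed
  have "openin ?T G"
    unfolding G_def by (intro openin_Union) (auto simp: I_def intro: openin_cylinder)
  then have K_closed: "closedin ?T K"
    unfolding K_def using C by (intro closedin_diff pattern_compact_imp_closedin)
  have K_sub: "K \<subseteq> C" "K \<subseteq> Pow A"
    using C by (auto simp: K_def pattern_compact_def)
  have "K = {}"
  proof (rule ccontr)
    assume "K \<noteq> {}"
    have "K \<inter> cylinder A s t \<inter> D \<noteq> {} \<and> (K - D) \<inter> cylinder A s t \<noteq> {}"
      if st: "finite s" "finite t" "s \<subseteq> A" "t \<subseteq> A" "K \<inter> cylinder A s t \<noteq> {}" for s t
    proof (rule ccontr)
      assume neg: "\<not> ?thesis"
      let ?V = "cylinder A s t"
      have V: "closedin ?T ?V" using st by (intro closedin_cylinder)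
      \<comment> \<open>Inside \<open>G\<close> the set is already F-sigma; the rest is either empty
        or all of the closed set \<open>?V \<inter> K\<close>, so the cylinder would belong to
        \<open>G\<close>.\<close>
      have "?V \<inter> D = (?V \<inter> (G \<inter> D)) \<union> (?V \<inter> K \<inter> D)"
        using D by (auto simp: K_def)
      moreover have "fsigma_in ?T (?V \<inter> (G \<inter> D))"
        by (rule fsigma_in_Int[OF closed_imp_fsigma_in[OF V] GD])
      moreover have "fsigma_in ?T (?V \<inter> K \<inter> D)"
      proof (cases "K \<inter> ?V \<inter> D = {}")
        case True
        then have "?V \<inter> K \<inter> D = {}" by blast
        then show ?thesis by simp
      next
        case False
        then have "?V \<inter> K \<inter> D = ?V \<inter> K" using neg by blast
        then show ?thesis using V K_closed by (simp add: closed_imp_fsigma_in closedin_Int)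
      qed
      ultimately have "(s, t) \<in> I" using st by (simp add: I_def fsigma_in_Un)
      then have "?V \<subseteq> G" by (auto simp: G_def)
      then show False using st by (auto simp: K_def)
    qed
    moreover have "\<exists>a\<in>A. (\<forall>X\<in>G'. a \<in> X) \<and> (\<forall>X\<in>H. a \<notin> X)"
      if "finite G'" "G' \<subseteq> K \<inter> D" "finite H" "H \<subseteq> K - D" for G' H
      using that K_sub by (intro sep) auto
    ultimately have "\<exists>a\<in>A. independent_in K (as @ [a])"
      if "set as \<subseteq> A" "independent_in K as" for as
      using that K_sub by (intro independent_in_extend[where D = D])
    then show False
      using dependent independent_sequence[OF \<open>K \<noteq> {}\<close> K_sub(1) C] by blast
  qed
  then have "D = G \<inter> D" using D by (auto simp: K_def)
  then show ?thesis using GD by simp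
qed


section \<open>Formulas\<close>

instance trm :: (countable) countable
  by countable_datatype

instance fm :: (countable, countable) countable
  by countable_datatype

lemma wf_trm_set: "wf_trm L t \<Longrightarrow> set_trm t \<subseteq> fun_syms L"
  by (induction t) auto

lemma wf_fm_set1: "wf_fm L \<phi> \<Longrightarrow> set1_fm \<phi> \<subseteq> fun_syms L"
  by (induction \<phi>) (use wf_trm_set in fastforce)+

lemma wf_fm_set2: "wf_fm L \<phi> \<Longrightarrow> set2_fm \<phi> \<subseteq> rel_syms L"
  by (induction \<phi>) auto

text \<open>The types of symbols may be uncountable, so formulas are recoded over the naturals. A
  well-formed formula uses symbols of \<open>L\<close> only, and on these the coding is
  injective.\<close>

lemma countable_wf_fm:
  assumes "countable_language L"
  shows "countable {\<phi>. wf_fm L \<phi>}"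
proof -
  let ?f = "map_fm (to_nat_on (fun_syms L)) (to_nat_on (rel_syms L))"
  have inj: "inj_on (to_nat_on (fun_syms L)) (fun_syms L)" "inj_on (to_nat_on (rel_syms L)) (rel_syms L)"
    using assms by (auto simp: countable_language_def)
  have "inj_on ?f {\<phi>. wf_fm L \<phi>}"
  proof (rule inj_onI)
    fix \<phi> \<psi> assume wf: "\<phi> \<in> {\<phi>. wf_fm L \<phi>}" "\<psi> \<in> {\<phi>. wf_fm L \<phi>}" and eq: "?f \<phi> = ?f \<psi>"
    show "\<phi> = \<psi>"
    proof (rule fm.inj_map_strong[OF _ _ eq])
      show "z = z'" if "z \<in> set1_fm \<phi>" "z' \<in> set1_fm \<psi>"
          "to_nat_on (fun_syms L) z = to_nat_on (fun_syms L) z'" for z z'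
        using that wf wf_fm_set1[of L] inj(1) by (auto dest!: inj_onD)
      show "z = z'" if "z \<in> set2_fm \<phi>" "z' \<in> set2_fm \<psi>"
          "to_nat_on (rel_syms L) z = to_nat_on (rel_syms L) z'" for z z'
        using that wf wf_fm_set2[of L] inj(2) by (auto dest!: inj_onD)
    qed
  qed
  then show ?thesis by (rule countableI')
qed

lemma finite_fv_trm: "finite (fv_trm t)"
  by (induction t) auto

lemma finite_fv: "finite (fv \<phi>)"
  by (induction \<phi>) (auto simp: finite_fv_trm)

section \<open>Renaming of variables\<close>

fun rename_trm :: "(nat \<Rightarrow> nat) \<Rightarrow> 'f trm \<Rightarrow> 'f trm" where
  "rename_trm \<pi> (Var i) = Var (\<pi> i)"
| "rename_trm \<pi> (Fn f ts) = Fn f (map (rename_trm \<pi>) ts)"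

text \<open>Bound variables are renamed as well, so an injective renaming cannot capture.\<close>

fun rename :: "(nat \<Rightarrow> nat) \<Rightarrow> ('f, 'r) fm \<Rightarrow> ('f, 'r) fm" where
  "rename \<pi> (Equal s t) = Equal (rename_trm \<pi> s) (rename_trm \<pi> t)"
| "rename \<pi> (Rel r ts) = Rel r (map (rename_trm \<pi>) ts)"
| "rename \<pi> (Neg \<phi>) = Neg (rename \<pi> \<phi>)"
| "rename \<pi> (Conj \<phi> \<psi>) = Conj (rename \<pi> \<phi>) (rename \<pi> \<psi>)"
| "rename \<pi> (Exists i \<phi>) = Exists (\<pi> i) (rename \<pi> \<phi>)"

lemma wf_rename_trm: "wf_trm L t \<Longrightarrow> wf_trm L (rename_trm \<pi> t)"
  by (induction t) auto

lemma wf_rename: "wf_fm L \<phi> \<Longrightarrow> wf_fm L (rename \<pi> \<phi>)"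
  by (induction \<phi>) (auto simp: wf_rename_trm)

lemma fv_rename_trm: "fv_trm (rename_trm \<pi> t) = \<pi> ` fv_trm t"
  by (induction t) auto

lemma fv_rename: "inj \<pi> \<Longrightarrow> fv (rename \<pi> \<phi>) = \<pi> ` fv \<phi>"
  by (induction \<phi>) (auto simp: fv_rename_trm image_Un inj_image_mem_iff inj_eq)

lemma trm_val_rename: "trm_val M e (rename_trm \<pi> t) = trm_val M (e \<circ> \<pi>) t"
  by (induction t) (auto simp: comp_def intro!: arg_cong[where f = "fun_interp M _"])

lemma sat_rename:
  assumes "inj \<pi>"
  shows "sat M e (rename \<pi> \<phi>) \<longleftrightarrow> sat M (e \<circ> \<pi>) \<phi>"
proof (induction \<phi> arbitrary: e)
  case (Rel r ts)
  have "map (trm_val M e) (map (rename_trm \<pi>) ts) = map (trm_val M (e \<circ> \<pi>)) ts"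
    by (simp add: trm_val_rename)
  then show ?case by (simp only: rename.simps sat.simps)
next
  case (Exists i \<phi>)
  have "e(\<pi> i := a) \<circ> \<pi> = (e \<circ> \<pi>)(i := a)" for a
    using assms by (auto simp: fun_eq_iff inj_eq)
  then show ?case using Exists by (simp del: fun_upd_apply comp_apply)
qed (simp_all add: trm_val_rename)

section \<open>Finite conjunctions and blocks of quantifiers\<close>

lemma ex_big_conj:
  fixes \<Gamma> :: "('f, 'r) fm set"
  assumes "finite \<Gamma>" "\<forall>\<phi>\<in>\<Gamma>. wf_fm L \<phi>"
  shows "\<exists>\<xi>. wf_fm L \<xi> \<and> (\<forall>(M :: ('f, 'r, 'm) struct) e. sat M e \<xi> \<longleftrightarrow> (\<forall>\<phi>\<in>\<Gamma>. sat M e \<phi>))"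
  using assms
proof (induction \<Gamma>)
  case empty
  show ?case by (intro exI[of _ "Equal (Var 0) (Var 0)"]) simp
next
  case (insert \<phi> \<Gamma>)
  then obtain \<xi> where "wf_fm L \<xi> \<and> (\<forall>(M :: ('f, 'r, 'm) struct) e. sat M e \<xi> \<longleftrightarrow> (\<forall>\<phi>\<in>\<Gamma>. sat M e \<phi>))"
    by auto
  then show ?case using insert.prems by (intro exI[of _ "Conj \<phi> \<xi>"]) simp
qed

text \<open>Quantifiers are put in front one variable at a time. The values come from a total
  \<open>g\<close>, so the universe must be nonempty even when \<open>V\<close> is empty.\<close>

lemma ex_big_exists:
  fixes M :: "('f, 'r, 'm) struct"
  assumes "finite V" "wf_fm L \<phi>" "univ M \<noteq> {}"
  shows "\<exists>\<xi>. wf_fm L \<xi> \<and>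
    (\<forall>e. sat M e \<xi> \<longleftrightarrow> (\<exists>g. range g \<subseteq> univ M \<and> sat M (override_on e g V) \<phi>))"
  using assms(1)
proof (induction V)
  case empty
  obtain c where "c \<in> univ M" using assms(3) by blast
  then have "\<exists>g :: nat \<Rightarrow> 'm. range g \<subseteq> univ M" by (intro exI[of _ "\<lambda>_. c"]) auto
  then show ?case using assms(2) by (intro exI[of _ \<phi>]) simp
next
  case (insert v V)
  then obtain \<xi> where \<xi>: "wf_fm L \<xi>"
    "\<And>e. sat M e \<xi> \<longleftrightarrow> (\<exists>g. range g \<subseteq> univ M \<and> sat M (override_on e g V) \<phi>)" by auto
  have "sat M e (Exists v \<xi>) \<longleftrightarrow>
      (\<exists>g. range g \<subseteq> univ M \<and> sat M (override_on e g (insert v V)) \<phi>)" for e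
  proof
    assume "sat M e (Exists v \<xi>)"
    then obtain a g where "a \<in> univ M" "range g \<subseteq> univ M" "sat M (override_on (e(v := a)) g V) \<phi>"
      by (auto simp: \<xi>)
    moreover have "override_on (e(v := a)) g V = override_on e (g(v := a)) (insert v V)"
      using insert by (auto simp: override_on_def fun_eq_iff)
    ultimately show "\<exists>g. range g \<subseteq> univ M \<and> sat M (override_on e g (insert v V)) \<phi>"
      by (intro exI[of _ "g(v := a)"]) (auto simp: image_subset_iff)
  next
    assume "\<exists>g. range g \<subseteq> univ M \<and> sat M (override_on e g (insert v V)) \<phi>"
    then obtain g where "range g \<subseteq> univ M" "sat M (override_on e g (insert v V)) \<phi>" by blast
    moreover have "override_on (e(v := g v)) g V = override_on e g (insert v V)"
      using insert by (auto simp: override_on_def fun_eq_iff)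
    ultimately have "g v \<in> univ M" "sat M (e(v := g v)) \<xi>"
      by (auto simp: \<xi> intro!: exI[of _ g])
    then show "sat M e (Exists v \<xi>)" by auto
  qed
  then show ?case using \<xi>(1) by (intro exI[of _ "Exists v \<xi>"]) simp
qed


section \<open>Saturation\<close>

text \<open>Parameters are supplied by a single valuation \<open>e\<close> (with countable range) instead of lists, so
  that conjunctions and quantifications of formulas need no renaming of parameters.\<close>

lemma saturated_realise_variable:
  fixes M :: "('f, 'r, 'm) struct"
  assumes sat: "saturated L M" and unc: "uncountable (univ M)"
    and wf: "\<forall>\<phi>\<in>\<Gamma>. wf_fm L \<phi>" and e: "range e \<subseteq> univ M"
    and fin: "\<And>\<Delta>. finite \<Delta> \<Longrightarrow> \<Delta> \<subseteq> \<Gamma> \<Longrightarrow> \<exists>a\<in>univ M. \<forall>\<phi>\<in>\<Delta>. sat M (e(v := a)) \<phi>"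
  shows "\<exists>a\<in>univ M. \<forall>\<phi>\<in>\<Gamma>. sat M (e(v := a)) \<phi>"
proof -
  \<comment> \<open>\<open>v\<close> trades places with variable 0, the place of \<open>x\<close> in
    a formula with parameters.\<close>
  let ?\<tau> = "Transposition.transpose 0 v"
  have inj: "inj ?\<tau>" by (rule inj_on_transpose)
  \<comment> \<open>A bound for the renamed free variables; inserting 0 covers sentences, where the
    maximum would be over the empty set.\<close>
  define k where "k \<phi> = Max (insert 0 (?\<tau> ` fv \<phi>))" for \<phi> :: "('f, 'r) fm"
  \<comment> \<open>The list starts at index 1, since entry \<open>j\<close> is the value of
    variable \<open>j + 1\<close>.\<close>
  define h where "h \<phi> = (rename ?\<tau> \<phi>, map (e \<circ> ?\<tau>) [1..<Suc (k \<phi>)])" for \<phi>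
  have le_k: "?\<tau> i \<le> k \<phi>" if "i \<in> fv \<phi>" for i \<phi>
    unfolding k_def using that by (intro Max_ge) (auto simp: finite_fv)
  have sol: "a \<in> solutions M (h \<phi>) \<longleftrightarrow> sat M (e(v := a)) \<phi>" if "a \<in> univ M" for a \<phi>
  proof -
    have "(a # map (e \<circ> ?\<tau>) [1..<Suc (k \<phi>)]) ! (?\<tau> i) = (e(v := a)) i" if "i \<in> fv \<phi>" for i
    proof (cases "i = v")
      case False
      then have "?\<tau> i \<noteq> 0" by (auto simp: Transposition.transpose_def)
      then show ?thesis using False le_k[OF that]
        by (cases "?\<tau> i")
          (auto simp: nth_upt transpose_eq_iff Transposition.transpose_def split: if_splits simp del: upt_Suc)
    qed simp
    then have "sat M (nth (a # map (e \<circ> ?\<tau>) [1..<Suc (k \<phi>)]) \<circ> ?\<tau>) \<phi> = sat M (e(v := a)) \<phi>"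
      by (intro sat_cong) simp
    then show ?thesis using that by (simp add: solutions_def h_def sat_rename[OF inj])
  qed
  have "h ` \<Gamma> \<subseteq> param_formulas L (range e)"
    using wf le_k by (auto simp: h_def param_formulas_def wf_rename fv_rename[OF inj] less_Suc_eq_le
        simp del: upt_Suc)
  moreover have "\<exists>a\<in>univ M. \<forall>\<theta>\<in>q. a \<in> solutions M \<theta>" if q: "q \<subseteq> h ` \<Gamma>" "finite q" for q
  proof -
    obtain \<Delta> where \<Delta>: "finite \<Delta>" "\<Delta> \<subseteq> \<Gamma>" "q = h ` \<Delta>"
      using finite_subset_image[OF q(2,1)] by blast
    obtain a where "a \<in> univ M" "\<forall>\<phi>\<in>\<Delta>. sat M (e(v := a)) \<phi>"
      using fin[OF \<Delta>(1,2)] by blast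
    then show ?thesis using sol \<Delta>(3) by blast
  qed
  ultimately have "one_type L M (range e) (h ` \<Gamma>)"
    by (auto simp: one_type_def)
  \<comment> \<open>A countable parameter set is strictly smaller than an uncountable universe, so
    saturation applies.\<close>
  moreover have "range e \<prec> univ M"
    unfolding lesspoll_def using unc subset_imp_lepoll[OF e] countable_eqpoll[of "range e" "univ M"]
    by (auto simp: eqpoll_sym)
  ultimately have "\<exists>a\<in>univ M. \<forall>\<theta>\<in>h ` \<Gamma>. a \<in> solutions M \<theta>"
    using sat e unfolding saturated_def by blast
  then show ?thesis using sol by auto
qed

text \<open>Induction on \<open>V\<close>: the value of \<open>v\<close> is fixed first, realising
  all formulas which say that some finite part of \<open>\<Gamma>\<close> can still be satisfied by
  changing the values on \<open>V\<close>. The valuation is generalised because the induction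
  continues from \<open>e(v := a)\<close>.\<close>

lemma saturated_realise_variables:
  fixes M :: "('f, 'r, 'm) struct"
  assumes sat: "saturated L M" and unc: "uncountable (univ M)"
    and wf: "\<forall>\<phi>\<in>\<Gamma>. wf_fm L \<phi>"
  shows "finite V \<Longrightarrow> range e \<subseteq> univ M \<Longrightarrow>
    (\<And>\<Delta>. finite \<Delta> \<Longrightarrow> \<Delta> \<subseteq> \<Gamma> \<Longrightarrow>
      \<exists>g. range g \<subseteq> univ M \<and> (\<forall>\<phi>\<in>\<Delta>. sat M (override_on e g V) \<phi>)) \<Longrightarrow>
    \<exists>g. range g \<subseteq> univ M \<and> (\<forall>\<phi>\<in>\<Gamma>. sat M (override_on e g V) \<phi>)"
proof (induction V arbitrary: e rule: finite_induct)
  case empty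
  have "sat M e \<phi>" if "\<phi> \<in> \<Gamma>" for \<phi>
    using empty(2)[of "{\<phi>}"] that by auto
  then show ?case using empty by auto
next
  case (insert v V)
  have ne: "univ M \<noteq> {}" using unc by auto
  define \<Gamma>' where "\<Gamma>' = {\<xi>. wf_fm L \<xi> \<and> (\<exists>\<Delta>. finite \<Delta> \<and> \<Delta> \<subseteq> \<Gamma> \<and>
    (\<forall>d. sat M d \<xi> \<longleftrightarrow> (\<exists>g. range g \<subseteq> univ M \<and> (\<forall>\<phi>\<in>\<Delta>. sat M (override_on d g V) \<phi>))))}"
  have "\<exists>a\<in>univ M. \<forall>\<xi>\<in>\<Gamma>'. sat M (e(v := a)) \<xi>"
  proof (rule saturated_realise_variable[OF sat unc])
    fix \<Xi> assume \<Xi>: "finite \<Xi>" "\<Xi> \<subseteq> \<Gamma>'"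
    then have "\<forall>\<xi>\<in>\<Xi>. \<exists>\<Delta>. finite \<Delta> \<and> \<Delta> \<subseteq> \<Gamma> \<and>
      (\<forall>d. sat M d \<xi> \<longleftrightarrow> (\<exists>g. range g \<subseteq> univ M \<and> (\<forall>\<phi>\<in>\<Delta>. sat M (override_on d g V) \<phi>)))"
      by (auto simp: \<Gamma>'_def)
    then obtain F where F: "\<And>\<xi>. \<xi> \<in> \<Xi> \<Longrightarrow> finite (F \<xi>)" "\<And>\<xi>. \<xi> \<in> \<Xi> \<Longrightarrow> F \<xi> \<subseteq> \<Gamma>"
      "\<And>\<xi> d. \<xi> \<in> \<Xi> \<Longrightarrow> sat M d \<xi> \<longleftrightarrow>
        (\<exists>g. range g \<subseteq> univ M \<and> (\<forall>\<phi>\<in>F \<xi>. sat M (override_on d g V) \<phi>))"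
      by metis
    obtain g where g: "range g \<subseteq> univ M"
      "\<forall>\<phi>\<in>\<Union>(F ` \<Xi>). sat M (override_on e g (insert v V)) \<phi>"
      using insert.prems(2)[of "\<Union>(F ` \<Xi>)"] \<Xi>(1) F(1,2) by blast
    have "override_on (e(v := g v)) g V = override_on e g (insert v V)"
      using insert by (auto simp: override_on_def fun_eq_iff)
    then have "\<forall>\<xi>\<in>\<Xi>. sat M (e(v := g v)) \<xi>" using F(3) g by (auto intro!: exI[of _ g])
    then show "\<exists>a\<in>univ M. \<forall>\<xi>\<in>\<Xi>. sat M (e(v := a)) \<xi>" using g by blast
  qed (use insert in \<open>auto simp: \<Gamma>'_def\<close>)
  then obtain a where a: "a \<in> univ M" "\<And>\<xi>. \<xi> \<in> \<Gamma>' \<Longrightarrow> sat M (e(v := a)) \<xi>" by blast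
  have "\<exists>g. range g \<subseteq> univ M \<and> (\<forall>\<phi>\<in>\<Gamma>. sat M (override_on (e(v := a)) g V) \<phi>)"
  proof (rule insert.IH)
    show "range (e(v := a)) \<subseteq> univ M" using insert.prems a by (auto simp: image_subset_iff)
    fix \<Delta> assume \<Delta>: "finite \<Delta>" "\<Delta> \<subseteq> \<Gamma>"
    obtain \<psi> where \<psi>: "wf_fm L \<psi>" "\<And>d. sat M d \<psi> \<longleftrightarrow> (\<forall>\<phi>\<in>\<Delta>. sat M d \<phi>)"
      using ex_big_conj[of \<Delta> L] \<Delta> wf by (metis subsetD)
    obtain \<xi> where \<xi>: "wf_fm L \<xi>"
      "\<And>d. sat M d \<xi> \<longleftrightarrow> (\<exists>g. range g \<subseteq> univ M \<and> sat M (override_on d g V) \<psi>)"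
      using ex_big_exists[OF insert(1) \<psi>(1) ne] by auto
    have \<xi>_iff: "sat M d \<xi> \<longleftrightarrow>
        (\<exists>g. range g \<subseteq> univ M \<and> (\<forall>\<phi>\<in>\<Delta>. sat M (override_on d g V) \<phi>))" for d
      by (simp only: \<xi>(2) \<psi>(2))
    then have "\<xi> \<in> \<Gamma>'" using \<Delta> \<xi>(1) unfolding \<Gamma>'_def by blast
    then show "\<exists>g. range g \<subseteq> univ M \<and> (\<forall>\<phi>\<in>\<Delta>. sat M (override_on (e(v := a)) g V) \<phi>)"
      using a(2) \<xi>_iff by blast
  qed
  then obtain g where g: "range g \<subseteq> univ M" "\<forall>\<phi>\<in>\<Gamma>. sat M (override_on (e(v := a)) g V) \<phi>"
    by blast
  have "override_on (e(v := a)) g V = override_on e (g(v := a)) (insert v V)"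
    using insert by (auto simp: override_on_def fun_eq_iff)
  then show ?case
    using g a by (intro exI[of _ "g(v := a)"]) (auto simp: image_subset_iff simp del: fun_upd_apply, simp)
qed


section \<open>Traces of definable sets\<close>

definition traces :: "('f, 'r, 'm) struct \<Rightarrow> 'm set \<Rightarrow> ('f, 'r) fm \<Rightarrow> nat \<Rightarrow> 'm set set" where
  "traces M A \<phi> n = {solutions M (\<phi>, b) \<inter> A | b. length b = n \<and> set b \<subseteq> univ M}"

text \<open>A tuple \<open>y\<close> is sought with \<open>\<phi>(a, y)\<close> for \<open>a\<close>
  in \<open>s\<close> and its negation for \<open>a\<close> in \<open>t\<close>. These conditions
  have countably many parameters and are finitely satisfiable by assumption, so saturation, used for
  \<open>n\<close> variables, realises them.\<close>

lemma pattern_compact_traces: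
  fixes M :: "('f, 'r, 'm) struct"
  assumes sat: "saturated L M" and unc: "uncountable (univ M)"
    and A: "countable A" "A \<noteq> {}" "A \<subseteq> univ M"
    and \<phi>: "wf_fm L \<phi>" "fv \<phi> \<subseteq> {..<Suc n}"
  shows "pattern_compact A (traces M A \<phi> n)"
  unfolding pattern_compact_def
proof (intro conjI allI impI)
  fix s t
  assume "s \<subseteq> A \<and> t \<subseteq> A \<and> (\<forall>s' t'. finite s' \<and> s' \<subseteq> s \<and> finite t' \<and> t' \<subseteq> t \<longrightarrow>
    traces M A \<phi> n \<inter> cylinder A s' t' \<noteq> {})"
  then have st: "s \<subseteq> A" "t \<subseteq> A"
    and fin: "\<And>s' t'. finite s' \<Longrightarrow> s' \<subseteq> s \<Longrightarrow> finite t' \<Longrightarrow> t' \<subseteq> t \<Longrightarrow>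
      traces M A \<phi> n \<inter> cylinder A s' t' \<noteq> {}"
    by auto
  \<comment> \<open>Variables from \<open>Suc n\<close> on enumerate \<open>A\<close>, with
    \<open>idx a\<close> naming \<open>a\<close>. Variables 1 to \<open>n\<close> are kept for
    \<open>y\<close>; variable 0 gets a default by truncated subtraction and is not free in the
    formulas \<open>\<gamma> a\<close>.\<close>
  define e where "e k = from_nat_into A (k - Suc n)" for k
  define idx where "idx a = Suc n + to_nat_on A a" for a
  define \<pi> where "\<pi> a = Transposition.transpose 0 (idx a)" for a
  define \<gamma> where "\<gamma> a = rename (\<pi> a) \<phi>" for a
  have e_A: "range e \<subseteq> A" using A(2) by (auto simp: e_def intro: from_nat_into)
  have \<gamma>: "sat M (override_on e g {1..n}) (\<gamma> a) \<longleftrightarrow> a \<in> solutions M (\<phi>, map g [1..<Suc n])"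
    if "a \<in> A" for a g
  proof -
    have "sat M (override_on e g {1..n}) (\<gamma> a) = sat M (override_on e g {1..n} \<circ> \<pi> a) \<phi>"
      unfolding \<gamma>_def by (rule sat_rename) (simp add: \<pi>_def)
    also have "\<dots> = sat M (nth (a # map g [1..<Suc n])) \<phi>"
    proof (rule sat_cong)
      fix i assume "i \<in> fv \<phi>"
      then have "i < Suc n" using \<phi> by auto
      then show "(override_on e g {1..n} \<circ> \<pi> a) i = (a # map g [1..<Suc n]) ! i"
        using that A
        by (cases i) (auto simp: override_on_def \<pi>_def e_def idx_def Transposition.transpose_def nth_upt
            simp del: upt_Suc)
    qed
    finally show ?thesis using that A by (auto simp: solutions_def)
  qed
  have "\<exists>g. range g \<subseteq> univ M \<and>
    (\<forall>\<phi>\<in>\<gamma> ` s \<union> (Neg \<circ> \<gamma>) ` t. sat M (override_on e g {1..n}) \<phi>)"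
  proof (rule saturated_realise_variables[OF sat unc])
    fix \<Delta> assume \<Delta>: "finite \<Delta>" "\<Delta> \<subseteq> \<gamma> ` s \<union> (Neg \<circ> \<gamma>) ` t"
    obtain s' where s': "finite s'" "s' \<subseteq> s" "\<Delta> \<inter> \<gamma> ` s = \<gamma> ` s'"
      using finite_subset_image[of "\<Delta> \<inter> \<gamma> ` s" \<gamma> s] \<Delta> by auto
    obtain t' where t': "finite t'" "t' \<subseteq> t" "\<Delta> \<inter> (Neg \<circ> \<gamma>) ` t = (Neg \<circ> \<gamma>) ` t'"
      using finite_subset_image[of "\<Delta> \<inter> (Neg \<circ> \<gamma>) ` t" "Neg \<circ> \<gamma>" t] \<Delta> by auto
    obtain b where b: "length b = n" "set b \<subseteq> univ M"
      "s' \<subseteq> solutions M (\<phi>, b)" "solutions M (\<phi>, b) \<inter> A \<inter> t' = {}"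
      using fin[OF s'(1,2) t'(1,2)] by (auto simp: traces_def cylinder_def)
    obtain c where c: "c \<in> univ M" using A by blast
    \<comment> \<open>The tuple \<open>b\<close> sits at variables 1 to \<open>n\<close>, hence the
      shift by one; elsewhere \<open>c\<close> is an arbitrary filler.\<close>
    define g where "g i = (if 1 \<le> i \<and> i \<le> n then b ! (i - 1) else c)" for i
    have g: "range g \<subseteq> univ M"
      using b c nth_mem[of _ b] by (force simp: g_def)
    have map_g: "map g [1..<Suc n] = b"
      using b by (intro nth_equalityI) (auto simp: g_def nth_upt simp del: upt_Suc)
    have \<gamma>_b: "sat M (override_on e g {1..n}) (\<gamma> a) \<longleftrightarrow> a \<in> solutions M (\<phi>, b)" if "a \<in> A" for a
      using \<gamma>[OF that, of g] by (simp only: map_g)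
    have "\<forall>a\<in>s'. sat M (override_on e g {1..n}) (\<gamma> a)"
      using \<gamma>_b b(3) s'(2) st(1) by blast
    moreover have "\<forall>a\<in>t'. \<not> sat M (override_on e g {1..n}) (\<gamma> a)"
      using \<gamma>_b b(4) t'(2) st(2) by blast
    moreover have "\<Delta> \<subseteq> \<gamma> ` s' \<union> (Neg \<circ> \<gamma>) ` t'"
      using \<Delta>(2) unfolding s'(3)[symmetric] t'(3)[symmetric] by blast
    ultimately have "\<forall>\<phi>\<in>\<Delta>. sat M (override_on e g {1..n}) \<phi>" by auto
    then show "\<exists>g. range g \<subseteq> univ M \<and> (\<forall>\<phi>\<in>\<Delta>. sat M (override_on e g {1..n}) \<phi>)"
      using g by blast
  qed (use \<phi> e_A A in \<open>auto simp: \<gamma>_def wf_rename\<close>)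
  then obtain g where g: "range g \<subseteq> univ M"
    "\<forall>\<phi>\<in>\<gamma> ` s \<union> (Neg \<circ> \<gamma>) ` t. sat M (override_on e g {1..n}) \<phi>" by blast
  let ?b = "map g [1..<Suc n]"
  have "solutions M (\<phi>, ?b) \<inter> A \<in> traces M A \<phi> n"
    using g(1) unfolding traces_def by (intro CollectI exI[of _ ?b]) (auto simp del: upt_Suc)
  moreover have "solutions M (\<phi>, ?b) \<inter> A \<in> cylinder A s t"
  proof -
    have "a \<in> solutions M (\<phi>, ?b)" if "a \<in> s" for a
      using that st g(2) \<gamma>[of a g] by blast
    moreover have "a \<notin> solutions M (\<phi>, ?b)" if "a \<in> t" for a
    proof -
      have "Neg (\<gamma> a) \<in> \<gamma> ` s \<union> (Neg \<circ> \<gamma>) ` t" using that by auto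
      then have "sat M (override_on e g {1..n}) (Neg (\<gamma> a))" using g(2) by blast
      then show ?thesis using that st \<gamma>[of a g] by auto
    qed
    ultimately show ?thesis using st by (auto simp: cylinder_def simp del: upt_Suc)
  qed
  ultimately show "traces M A \<phi> n \<inter> cylinder A s t \<noteq> {}" by blast
qed (auto simp: traces_def)

text \<open>Choosing for each \<open>w\<close> a parameter tuple that defines \<open>X w\<close>
  gives the configuration forbidden by NIP, with tuples of length 1 on the left.\<close>

lemma NIP_no_independent_traces:
  assumes "NIP_in L M" "A \<subseteq> univ M" "wf_fm L \<phi>" "fv \<phi> \<subseteq> {..<Suc n}"
  shows "\<not> (\<exists>a X. range a \<subseteq> A \<and> range X \<subseteq> traces M A \<phi> n \<and> (\<forall>i w. a (i::nat) \<in> X w \<longleftrightarrow> i \<in> w))"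
proof
  assume "\<exists>a X. range a \<subseteq> A \<and> range X \<subseteq> traces M A \<phi> n \<and> (\<forall>i w. a (i::nat) \<in> X w \<longleftrightarrow> i \<in> w)"
  then obtain a X where a: "\<And>i::nat. a i \<in> A" and X: "\<And>w. X w \<in> traces M A \<phi> n"
    and aX: "\<And>i w. a i \<in> X w \<longleftrightarrow> i \<in> w"
    by (auto simp: image_subset_iff)
  have "\<forall>w. \<exists>b. length b = n \<and> set b \<subseteq> univ M \<and> X w = solutions M (\<phi>, b) \<inter> A"
    using X by (auto simp: traces_def)
  then obtain b where b: "\<And>w. length (b w) = n" "\<And>w. set (b w) \<subseteq> univ M"
    "\<And>w. X w = solutions M (\<phi>, b w) \<inter> A"
    by metis
  have "sat M (nth ([a i] @ b w)) \<phi> \<longleftrightarrow> i \<in> w" for i w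
    using aX[of i w] a[of i] assms(2) by (auto simp: b(3) solutions_def)
  then have "\<exists>\<phi> m n (a :: nat \<Rightarrow> 'c list) b. wf_fm L \<phi> \<and> fv \<phi> \<subseteq> {..<m + n} \<and>
      (\<forall>i. length (a i) = m \<and> set (a i) \<subseteq> univ M) \<and>
      (\<forall>w. length (b w) = n \<and> set (b w) \<subseteq> univ M) \<and>
      (\<forall>i w. sat M (nth (a i @ b w)) \<phi> \<longleftrightarrow> i \<in> w)"
    using assms a b by (intro exI[of _ \<phi>] exI[of _ 1] exI[of _ n] exI[of _ "\<lambda>i. [a i]"] exI[of _ b]) auto
  then show False using assms(1) unfolding NIP_in_def by blast
qed


section \<open>Complete types\<close>

lemma complete_one_type_subset: "complete_one_type L M A p \<Longrightarrow> p \<subseteq> param_formulas L A"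
  by (simp add: complete_one_type_def one_type_def)

lemma complete_one_type_Neg:
  assumes "complete_one_type L M A p" "(\<phi>, b) \<in> param_formulas L A" "(\<phi>, b) \<notin> p"
  shows "(Neg \<phi>, b) \<in> p"
  using assms by (auto simp: complete_one_type_def)

lemma solutions_Neg: "solutions M (Neg \<phi>, b) = univ M - solutions M (\<phi>, b)"
  by (auto simp: solutions_def)

text \<open>Otherwise the negation of \<open>\<theta>\<close> is in \<open>p\<close> by
  completeness, and together with \<open>q\<close> it forms a finite part of \<open>p\<close>
  without a solution.\<close>

lemma complete_one_type_closed:
  assumes p: "complete_one_type L M A p" and q: "finite q" "q \<subseteq> p"
    and \<theta>: "\<theta> \<in> param_formulas L A"
    and imp: "\<And>a. a \<in> univ M \<Longrightarrow> (\<forall>\<eta>\<in>q. a \<in> solutions M \<eta>) \<Longrightarrow> a \<in> solutions M \<theta>"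
  shows "\<theta> \<in> p"
proof (rule ccontr)
  assume "\<theta> \<notin> p"
  then have "(Neg (fst \<theta>), snd \<theta>) \<in> p"
    using complete_one_type_Neg[OF p] \<theta> by simp
  then have "insert (Neg (fst \<theta>), snd \<theta>) q \<subseteq> p" "finite (insert (Neg (fst \<theta>), snd \<theta>) q)"
    using q by auto
  then have "\<exists>a\<in>univ M. \<forall>\<eta>\<in>insert (Neg (fst \<theta>), snd \<theta>) q. a \<in> solutions M \<eta>"
    using p unfolding complete_one_type_def one_type_def by blast
  then show False using imp by (auto simp: solutions_Neg)
qed

text \<open>The parameter lists are concatenated. The second formula is renamed so that
  \<open>x\<close> stays variable 0 and its parameters move past those of the first.\<close>

lemma ex_param_conj:
  assumes \<theta>: "\<theta> \<in> param_formulas L A" and \<eta>: "\<eta> \<in> param_formulas L A"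
  shows "\<exists>\<zeta>\<in>param_formulas L A. solutions M \<zeta> = solutions M \<theta> \<inter> solutions M \<eta>"
proof -
  obtain \<phi> b \<psi> c where eq: "\<theta> = (\<phi>, b)" "\<eta> = (\<psi>, c)" by (metis surj_pair)
  have wf: "wf_fm L \<phi>" "fv \<phi> \<subseteq> {..<Suc (length b)}" "set b \<subseteq> A"
    "wf_fm L \<psi>" "fv \<psi> \<subseteq> {..<Suc (length c)}" "set c \<subseteq> A"
    using \<theta> \<eta> by (auto simp: eq param_formulas_def)
  define \<pi> where "\<pi> k = (if k = 0 then 0 else k + length b)" for k :: nat
  have inj: "inj \<pi>" by (rule injI) (auto simp: \<pi>_def split: if_splits)
  let ?\<zeta> = "(Conj \<phi> (rename \<pi> \<psi>), b @ c)"
  have "sat M (nth (a # b @ c)) \<phi> \<longleftrightarrow> sat M (nth (a # b)) \<phi>" for a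
  proof (rule sat_cong)
    fix i assume "i \<in> fv \<phi>"
    then show "(a # b @ c) ! i = (a # b) ! i"
      using wf by (cases i) (auto simp: nth_append)
  qed
  moreover have "sat M (nth (a # b @ c)) (rename \<pi> \<psi>) \<longleftrightarrow> sat M (nth (a # c)) \<psi>" for a
    unfolding sat_rename[OF inj]
  proof (rule sat_cong)
    fix i show "((!) (a # b @ c) \<circ> \<pi>) i = (a # c) ! i"
      by (cases i) (auto simp: \<pi>_def nth_append)
  qed
  ultimately have "solutions M ?\<zeta> = solutions M \<theta> \<inter> solutions M \<eta>"
    by (auto simp: solutions_def eq)
  moreover have "?\<zeta> \<in> param_formulas L A"
    using wf by (fastforce simp: param_formulas_def wf_rename fv_rename[OF inj] \<pi>_def)
  ultimately show ?thesis by blast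
qed

text \<open>Finite satisfiability is formulated for single formulas, so the finite set
  \<open>q\<close> is first merged into one formula of \<open>p\<close> by conjunction.\<close>

lemma complete_one_type_common_solution:
  assumes p: "complete_one_type L M (univ M) p" and fs: "finitely_satisfiable_in M p A"
    and A: "A \<noteq> {}" "A \<subseteq> univ M" and q: "finite q" "q \<subseteq> p"
  shows "\<exists>a\<in>A. \<forall>\<theta>\<in>q. a \<in> solutions M \<theta>"
proof -
  \<comment> \<open>The empty \<open>q\<close> is set apart: its intersection is the universal set
    of the type, which need not be a solution set.\<close>
  have "q = {} \<or> (\<exists>\<zeta>\<in>p. solutions M \<zeta> = (\<Inter>\<theta>\<in>q. solutions M \<theta>))"
    using q
  proof (induction q)
    case (insert \<theta> q)
    show ?case
    proof (cases "q = {}")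
      case True
      then show ?thesis using insert by auto
    next
      case False
      then obtain \<eta> where \<eta>: "\<eta> \<in> p" "solutions M \<eta> = (\<Inter>\<theta>\<in>q. solutions M \<theta>)"
        using insert by auto
      obtain \<zeta> where \<zeta>: "\<zeta> \<in> param_formulas L (univ M)" "solutions M \<zeta> = solutions M \<theta> \<inter> solutions M \<eta>"
        using ex_param_conj[of \<theta> L "univ M" \<eta>] complete_one_type_subset[OF p] insert.prems \<eta> by blast
      have "\<zeta> \<in> p"
        by (rule complete_one_type_closed[OF p, of "{\<theta>, \<eta>}"]) (use insert.prems \<eta> \<zeta> in auto)
      then show ?thesis using \<zeta> \<eta> by auto
    qed
  qed simp
  then show ?thesis
  proof (elim disjE bexE)
    fix \<zeta> assume \<zeta>: "\<zeta> \<in> p" "solutions M \<zeta> = (\<Inter>\<theta>\<in>q. solutions M \<theta>)"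
    then obtain a where "a \<in> A" "a \<in> solutions M \<zeta>"
      using fs unfolding finitely_satisfiable_in_def by blast
    then show ?thesis unfolding \<zeta>(2) by blast
  qed (use A in auto)
qed

section \<open>Passage from one formula to the whole type\<close>

theorem theorem3p5:
  fixes L :: "('f, 'r) language"
    and T :: "('f, 'r) fm set"
    and M N :: "('f, 'r, 'm) struct"
    and p :: "('f, 'r, 'm) pfm set"
    and U :: "'m set set"
  assumes "countable_language L"
    and "complete_theory L T"
    and "is_model L T M" and "saturated L M"
    and "NIP_in L M"
    and "elementary_substructure L N M" and "countable (univ N)"
    and "complete_one_type L M (univ M) p"
    and "finitely_satisfiable_in M p (univ N)"
    and "U = {X \<inter> univ N | X. X \<in> sets_of_type M p}"
  shows "borel_in (powerset_topology (univ N)) U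
       \<and> fsigma_in (powerset_topology (univ N)) U"
proof -
  let ?A = "univ N"
  have A: "?A \<noteq> {}" "?A \<subseteq> univ M"
    using assms by (auto simp: elementary_substructure_def is_structure_def)
  have p_sub: "p \<subseteq> param_formulas L (univ M)"
    using assms by (intro complete_one_type_subset)
  have U: "U = (\<lambda>\<theta>. solutions M \<theta> \<inter> ?A) ` p"
    using assms by (auto simp: sets_of_type_def)
  \<comment> \<open>Saturation speaks of parameter sets smaller than the universe, so it covers
    countable infinite ones only in an uncountable model; over a countable model there are only
    countably many formulas with parameters.\<close>
  have "fsigma_in (powerset_topology ?A) U"
  proof (cases "countable (univ M)")
    case True
    then have "countable ({\<phi>. wf_fm L \<phi>} \<times> lists (univ M))"
      using assms by (intro countable_SIGMA countable_wf_fm countable_lists)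
    then have "countable p"
      by (rule countable_subset[rotated]) (use p_sub in \<open>auto simp: param_formulas_def\<close>)
    then show ?thesis
      by (intro countable_imp_fsigma_in_powerset_topology) (auto simp: U)
  next
    case False
    define D where "D \<phi> n = {solutions M (\<phi>, b) \<inter> ?A | b. length b = n \<and> (\<phi>, b) \<in> p}" for \<phi> n
    define J where "J = {(\<phi>, n). wf_fm L \<phi> \<and> fv \<phi> \<subseteq> {..<Suc n}}"
    have "fsigma_in (powerset_topology ?A) (D \<phi> n)" if J: "wf_fm L \<phi>" "fv \<phi> \<subseteq> {..<Suc n}" for \<phi> n
    proof (rule fsigma_in_if_no_independent_sequence)
      show "pattern_compact ?A (traces M ?A \<phi> n)"
        using assms False A J by (intro pattern_compact_traces)
      show "\<not> (\<exists>a X. range a \<subseteq> ?A \<and> range X \<subseteq> traces M ?A \<phi> n \<and> (\<forall>i w. a (i::nat) \<in> X w \<longleftrightarrow> i \<in> w))"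
        using assms A J by (intro NIP_no_independent_traces)
      show "D \<phi> n \<subseteq> traces M ?A \<phi> n"
        using p_sub by (fastforce simp: D_def traces_def param_formulas_def)
    next
      fix G H assume GH: "finite G" "G \<subseteq> D \<phi> n" "finite H" "H \<subseteq> traces M ?A \<phi> n - D \<phi> n"
      have "\<forall>X\<in>G. \<exists>\<theta>\<in>p. X = solutions M \<theta> \<inter> ?A"
        using GH by (fastforce simp: D_def)
      then obtain P where P: "\<And>X. X \<in> G \<Longrightarrow> P X \<in> p \<and> X = solutions M (P X) \<inter> ?A" by metis
      have "\<exists>\<theta>\<in>p. X = ?A - solutions M \<theta>" if "X \<in> H" for X
      proof -
        have X: "X \<in> traces M ?A \<phi> n" "X \<notin> D \<phi> n"
          using that GH by auto
        obtain b where b: "length b = n" "set b \<subseteq> univ M" "X = solutions M (\<phi>, b) \<inter> ?A"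
          using X(1) unfolding traces_def by blast
        \<comment> \<open>Any tuple defining a trace outside \<open>D\<close> has its formula
          outside \<open>p\<close>, so completeness supplies the negation.\<close>
        have "(\<phi>, b) \<notin> p"
          using X(2) b(1,3) unfolding D_def by blast
        then have "(Neg \<phi>, b) \<in> p"
          using assms J b by (intro complete_one_type_Neg) (auto simp: param_formulas_def)
        then show ?thesis
          using b A by (intro bexI[of _ "(Neg \<phi>, b)"]) (auto simp: solutions_Neg)
      qed
      then obtain Q where Q: "\<And>X. X \<in> H \<Longrightarrow> Q X \<in> p \<and> X = ?A - solutions M (Q X)" by metis
      \<comment> \<open>A common solution in \<open>?A\<close> lies in every member of
        \<open>G\<close> and, through the negations, in no member of \<open>H\<close>.\<close>
      have "\<exists>a\<in>?A. \<forall>\<theta>\<in>P ` G \<union> Q ` H. a \<in> solutions M \<theta>"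
        using assms A GH P Q by (intro complete_one_type_common_solution) auto
      then obtain a where "a \<in> ?A" "\<forall>\<theta>\<in>P ` G \<union> Q ` H. a \<in> solutions M \<theta>" by blast
      then show "\<exists>a\<in>?A. (\<forall>X\<in>G. a \<in> X) \<and> (\<forall>X\<in>H. a \<notin> X)"
        using P Q by (intro bexI[of _ a]) blast+
    qed (use assms in auto)
    moreover have "countable J"
    proof (rule countable_subset)
      show "J \<subseteq> {\<phi>. wf_fm L \<phi>} \<times> UNIV" by (auto simp: J_def)
      show "countable ({\<phi>. wf_fm L \<phi>} \<times> (UNIV :: nat set))"
        using assms by (intro countable_SIGMA countable_wf_fm) auto
    qed
    ultimately have "fsigma_in (powerset_topology ?A) (\<Union>((\<lambda>(\<phi>, n). D \<phi> n) ` J))"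
      by (intro fsigma_in_Union) (auto simp: J_def)
    moreover have "U = \<Union>((\<lambda>(\<phi>, n). D \<phi> n) ` J)"
    proof (intro equalityI subsetI)
      fix X assume "X \<in> U"
      then obtain \<phi> b where b: "(\<phi>, b) \<in> p" "X = solutions M (\<phi>, b) \<inter> ?A"
        by (auto simp: U)
      then have "(\<phi>, length b) \<in> J" "X \<in> D \<phi> (length b)"
        using p_sub by (auto simp: J_def D_def param_formulas_def)
      then show "X \<in> \<Union>((\<lambda>(\<phi>, n). D \<phi> n) ` J)" by blast
    qed (auto simp: U D_def)
    ultimately show ?thesis by simp
  qed
  then show ?thesis using fsigma_in_imp_borel_in by blast
qed

end
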